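(* Let $n \geq 2$ and let $(s_1,\dots,s_{n-1},p)\in\mathbb{C}^n$. Then the following are equivalent: (i) $(s_1,\dots,s_{n-1},p)\in \Gamma_n$. (ii) $|p| \leq 1$ and there exists $(\beta_1,\dots,\beta_{n-1})\in\Gamma_{n-1}$ such that $s_j=\beta_j+\overline{\beta_{n-j}}\,p$ for all $j=1,\dots, n-1$.
   Context: Let $\mathbb{D}=\{z\in\mathbb{C}:|z|<1\}$. For $n\ge 2$, the symmetrization map $\pi_n:\mathbb{C}^n\to\mathbb{C}^n$ is $\pi_n(z_1,\dots,z_n)=(e_1,\dots,e_n)$, where $e_k=\sum_{1\le i_1<\dots<i_k\le n} z_{i_1}\cdots z_{i_k}$ is the $k$-th elementary symmetric polynomial in $z_1,\dots,z_n$. Set $\mathbb{G}_n=\{\pi_n(\boldsymbol{z}):\boldsymbol{z}\in\mathbb{D}^n\}$ and let $\Gamma_n=\overline{\mathbb{G}_n}$ be its closure in $\mathbb{C}^n$ (the symmetrized polydisc). For $n=1$, $\Gamma_1=\overline{\mathbb{D}}$ is the closed unit disc. *)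

theory Defs
  imports "HOL-Analysis.Analysis"
begin

text \<open>
  The space \<open>\<complex>\<^sup>n\<close> is rendered as \<open>{1..n} \<rightarrow>\<^sub>E UNIV\<close>, the extensional functions on
  \<open>{1..n}\<close>, so that \<open>n\<close> can vary; \<open>complex_space n\<close> is this set with its usual topology.
\<close>

definition complex_space :: "nat \<Rightarrow> (nat \<Rightarrow> complex) topology" where
  "complex_space n = product_topology (\<lambda>_. euclidean) {1..n}"

definition elem_sym :: "nat \<Rightarrow> nat \<Rightarrow> (nat \<Rightarrow> complex) \<Rightarrow> complex" where
  "elem_sym n k z = (\<Sum>I | I \<subseteq> {1..n} \<and> card I = k. \<Prod>i\<in>I. z i)"

definition symmetrization :: "nat \<Rightarrow> (nat \<Rightarrow> complex) \<Rightarrow> (nat \<Rightarrow> complex)" where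
  "symmetrization n z = (\<lambda>k\<in>{1..n}. elem_sym n k z)"

definition open_sym_polydisc :: "nat \<Rightarrow> (nat \<Rightarrow> complex) set" where
  "open_sym_polydisc n = symmetrization n ` ({1..n} \<rightarrow>\<^sub>E ball 0 1)"

definition sym_polydisc :: "nat \<Rightarrow> (nat \<Rightarrow> complex) set" where
  "sym_polydisc n = complex_space n closure_of open_sym_polydisc n"

lemma sym_polydisc_1: "sym_polydisc 1 = ({1..1} \<rightarrow>\<^sub>E cball 0 1)"
proof -
  have subsets: "{I. I \<subseteq> {1..1::nat} \<and> card I = 1} = {{1}}"
    by (auto simp: subset_singleton_iff)
  have "symmetrization 1 z = z" if "z \<in> {1..1} \<rightarrow>\<^sub>E ball 0 1" for z
  proof
    fix k
    show "symmetrization 1 z k = z k"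
    proof (cases "k = 1")
      case True
      then show ?thesis using subsets by (simp add: symmetrization_def elem_sym_def)
    next
      case False
      then show ?thesis using that by (auto simp: symmetrization_def PiE_def extensional_def)
    qed
  qed
  then have "open_sym_polydisc 1 = ({1..1} \<rightarrow>\<^sub>E ball 0 1)"
    unfolding open_sym_polydisc_def by simp
  then show ?thesis
    by (simp add: sym_polydisc_def complex_space_def closure_of_product_topology
        flip: closure_ball)
qed

end

theory Submission
  imports Defs "HOL-Computational_Algebra.Fundamental_Theorem_Algebra"
begin

text \<open>
  With \<open>\<sigma> 0 = 1\<close>, a tuple \<open>\<sigma>\<close> lies in the open symmetrized polydisc iff the polynomial
  \<open>f w = (\<Sum>k\<le>n. \<sigma> k * w ^ k)\<close>, which is \<open>\<Prod>i. 1 + z i * w\<close> when \<open>\<sigma>\<close> is the symmetrization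
  of \<open>z\<close>, has no zero in the closed unit disc. In that case its conjugate reversal \<open>f\<^sup>*\<close> satisfies
  \<open>\<bar>f\<^sup>*\<bar> \<le> \<bar>f\<bar>\<close> there. If \<open>s j = \<beta> j + cnj (\<beta> (n - j)) * p\<close> then, as in the Schur-Cohn algorithm,
  \<open>f\<^sub>s = f\<^sub>\<beta> + p w f\<^sub>\<beta>\<^sup>*\<close> and \<open>(1 - \<bar>p\<bar>\<^sup>2) f\<^sub>\<beta> = f\<^sub>s - p f\<^sub>s\<^sup>*\<close>, so for \<open>\<bar>p\<bar> < 1\<close> either of \<open>f\<^sub>s\<close>, \<open>f\<^sub>\<beta>\<close> is
  zero-free iff the other is. Thus the continuous map \<open>(\<beta>, p) \<mapsto> (s, p)\<close> carries the product of
  the open symmetrized polydisc and the open disc onto the next open symmetrized polydisc. Since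
  the closures are compact, it also carries closure onto closure, which covers \<open>\<bar>p\<bar> = 1\<close>.
\<close>

section \<open>Elementary symmetric polynomials as coefficients of products of linear
  factors\<close>

lemma prod_linear_eq_elem_sym:
  "(\<Prod>i\<in>{1..n}. u + z i * v) = (\<Sum>k\<le>n. elem_sym n k z * v ^ k * u ^ (n - k))"
proof -
  let ?g = "\<lambda>I. (\<Prod>i\<in>I. z i) * v ^ card I * u ^ (n - card I)"
  have "(\<Prod>i\<in>{1..n}. u + z i * v) = (\<Prod>i\<in>{1..n}. z i * v + u)"
    by (simp add: add.commute)
  also have "\<dots> = (\<Sum>I\<in>Pow {1..n}. (\<Prod>i\<in>I. z i * v) * (\<Prod>i\<in>{1..n} - I. u))"
    by (rule prod_add) simp
  also have "\<dots> = (\<Sum>I\<in>Pow {1..n}. ?g I)"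
    by (intro sum.cong refl) (auto simp: prod.distrib card_Diff_subset finite_subset)
  also have "\<dots> = (\<Sum>k\<le>n. sum ?g {I \<in> Pow {1..n}. card I = k})"
    by (rule sum.group[symmetric]) (auto dest: card_mono[rotated])
  also have "\<dots> = (\<Sum>k\<le>n. elem_sym n k z * v ^ k * u ^ (n - k))"
    by (intro sum.cong refl) (auto simp: elem_sym_def sum_distrib_right intro!: sum.cong)
  finally show ?thesis .
qed

lemma elem_sym_0: "elem_sym n 0 z = 1"
proof -
  have "{I. I \<subseteq> {1..n} \<and> card I = 0} = {{}}"
    by (auto simp: card_eq_0_iff dest: finite_subset)
  then show ?thesis by (simp add: elem_sym_def)
qed

lemma elem_sym_top: "elem_sym n n z = (\<Prod>i\<in>{1..n}. z i)"
proof -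
  have "{I. I \<subseteq> {1..n} \<and> card I = n} = {{1..n}}"
    using card_subset_eq[of "{1..n}"] by auto
  then show ?thesis by (simp add: elem_sym_def)
qed

lemma elem_sym_cnj: "elem_sym n k (\<lambda>i. cnj (z i)) = cnj (elem_sym n k z)"
  by (simp add: elem_sym_def)

text \<open>A tuple on \<open>{1..n}\<close> carries no meaningful value at 0, so the constant
  coefficient is set to 1 by overriding it.\<close>

definition gen_poly :: "nat \<Rightarrow> (nat \<Rightarrow> complex) \<Rightarrow> complex \<Rightarrow> complex" where
  "gen_poly n \<sigma> w = (\<Sum>k\<le>n. (\<sigma>(0 := 1)) k * w ^ k)"

text \<open>For w nonzero this is w^n * cnj (f (1 / cnj w)), where f is
  \<open>gen_poly n \<sigma>\<close>. Reversing at the formal degree n makes sense even if the top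
  coefficient vanishes.\<close>

definition gen_poly_rev :: "nat \<Rightarrow> (nat \<Rightarrow> complex) \<Rightarrow> complex \<Rightarrow> complex" where
  "gen_poly_rev n \<sigma> w = (\<Sum>k\<le>n. cnj ((\<sigma>(0 := 1)) k) * w ^ (n - k))"

lemma gen_poly_symmetrization: "gen_poly n (symmetrization n z) w = (\<Prod>i\<in>{1..n}. 1 + z i * w)"
  unfolding gen_poly_def prod_linear_eq_elem_sym
  by (intro sum.cong refl) (auto simp: symmetrization_def elem_sym_0)

lemma gen_poly_rev_symmetrization:
  "gen_poly_rev n (symmetrization n z) w = (\<Prod>i\<in>{1..n}. w + cnj (z i))"
proof -
  \<comment> \<open>The explicit factor 1 matches the homogeneous expansion with u = w and v = 1,
    which reverses the powers of w.\<close>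
  have "(\<Prod>i\<in>{1..n}. w + cnj (z i)) = (\<Prod>i\<in>{1..n}. w + cnj (z i) * 1)" by simp
  also have "\<dots> = gen_poly_rev n (symmetrization n z) w"
    unfolding gen_poly_rev_def prod_linear_eq_elem_sym
    by (intro sum.cong refl) (auto simp: symmetrization_def elem_sym_0 elem_sym_cnj)
  finally show ?thesis by simp
qed

text \<open>Induction splits off one root r at a time. The value 1 at 0 forces r to be nonzero, so
  the factor can be normalized to 1 - w / r and its cofactor \<open>smult (- r) Q\<close> is again 1
  at 0. A degree below n is absorbed by entries z i = 0.\<close>

lemma complex_poly_factorization:
  fixes P :: "complex poly"
  assumes "degree P \<le> n" "poly P 0 = 1"
  shows "\<exists>z. \<forall>w. poly P w = (\<Prod>i\<in>{1..n}. 1 + z i * w)"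
  using assms
proof (induction n arbitrary: P)
  case 0
  then have "P = [:1:]" by (auto elim!: degree_eq_zeroE)
  then show ?case by simp
next
  case (Suc n)
  show ?case
  proof (cases "degree P = 0")
    case True
    then have "P = [:1:]" using Suc.prems by (auto elim!: degree_eq_zeroE)
    then show ?thesis by (intro exI[of _ "\<lambda>_. 0"]) simp
  next
    case False
    then have "\<not> constant (poly P)" by (simp add: constant_degree)
    then obtain r where r: "poly P r = 0" using fundamental_theorem_of_algebra by blast
    then obtain Q where Q: "P = [:-r, 1:] * Q" by (auto simp: poly_eq_0_iff_dvd)
    have Q0: "- r * poly Q 0 = 1" using Suc.prems Q by simp
    then have "r \<noteq> 0" "Q \<noteq> 0" by auto
    have "degree P = Suc (degree Q)" unfolding Q using \<open>Q \<noteq> 0\<close>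
      by (subst degree_mult_eq) auto
    then have "degree (smult (- r) Q) \<le> n" "poly (smult (- r) Q) 0 = 1"
      using Suc.prems Q0 by auto
    from Suc.IH[OF this] obtain z
      where z: "\<And>w. poly (smult (- r) Q) w = (\<Prod>i\<in>{1..n}. 1 + z i * w)" by auto
    have "poly P w = (\<Prod>i\<in>{1..Suc n}. 1 + (z(Suc n := - 1 / r)) i * w)" for w
    proof -
      have "(\<Prod>i\<in>{1..n}. 1 + (z(Suc n := - 1 / r)) i * w) = (\<Prod>i\<in>{1..n}. 1 + z i * w)"
        by (intro prod.cong) auto
      then have "(\<Prod>i\<in>{1..Suc n}. 1 + (z(Suc n := - 1 / r)) i * w)
          = poly (smult (- r) Q) w * (1 - w / r)"
        unfolding z by (simp add: prod.nat_ivl_Suc')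
      also have "\<dots> = poly P w"
        using \<open>r \<noteq> 0\<close> unfolding Q by (simp add: field_simps)
      finally show ?thesis by simp
    qed
    then show ?thesis by blast
  qed
qed

section \<open>The open symmetrized polydisc and zero-free polynomials\<close>

lemma open_sym_polydiscE:
  assumes "\<sigma> \<in> open_sym_polydisc n"
  obtains z where "\<And>i. i \<in> {1..n} \<Longrightarrow> cmod (z i) < 1" "\<sigma> = symmetrization n z"
proof -
  obtain z where "z \<in> {1..n} \<rightarrow>\<^sub>E ball 0 1" "\<sigma> = symmetrization n z"
    using assms unfolding open_sym_polydisc_def by blast
  then show thesis using that[of z] by (auto simp: PiE_iff)
qed

text \<open>The zeros of the product of the factors 1 + z i * w are the points -1 / z i with z i
  nonzero, and these lie outside the closed disc exactly when |z i| < 1. Conversely, the z i come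
  from factoring the polynomial, and comparing coefficients recovers \<sigma>.\<close>

lemma in_open_sym_polydisc_iff:
  assumes "\<sigma> \<in> extensional {1..n}"
  shows "\<sigma> \<in> open_sym_polydisc n \<longleftrightarrow> (\<forall>w. cmod w \<le> 1 \<longrightarrow> gen_poly n \<sigma> w \<noteq> 0)"
proof
  assume "\<sigma> \<in> open_sym_polydisc n"
  then obtain z where z: "\<And>i. i \<in> {1..n} \<Longrightarrow> cmod (z i) < 1" and \<sigma>: "\<sigma> = symmetrization n z"
    by (rule open_sym_polydiscE) blast
  show "\<forall>w. cmod w \<le> 1 \<longrightarrow> gen_poly n \<sigma> w \<noteq> 0"
  proof (intro allI impI notI)
    fix w assume w: "cmod w \<le> 1" and "gen_poly n \<sigma> w = 0"
    then obtain i where i: "i \<in> {1..n}" "1 + z i * w = 0"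
      by (auto simp: \<sigma> gen_poly_symmetrization)
    then have "z i * w = - 1" by (simp add: add_eq_0_iff)
    then have "cmod (z i) * cmod w = 1" by (metis norm_minus_cancel norm_mult norm_one)
    moreover have "cmod (z i) * cmod w \<le> cmod (z i)"
      using w by (simp add: mult_left_le)
    ultimately show False using z[OF i(1)] by linarith
  qed
next
  assume nz: "\<forall>w. cmod w \<le> 1 \<longrightarrow> gen_poly n \<sigma> w \<noteq> 0"
  define P where "P = (\<Sum>k\<le>n. monom ((\<sigma>(0 := 1)) k) k)"
  have P: "poly P w = gen_poly n \<sigma> w" for w
    by (simp add: P_def gen_poly_def poly_sum poly_monom)
  have "degree P \<le> n"
    unfolding P_def by (intro degree_sum_le) (auto intro: order.trans[OF degree_monom_le])
  moreover have "poly P 0 = 1"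
    by (simp add: P gen_poly_def sum.atMost_shift)
  ultimately obtain z where z: "\<And>w. gen_poly n \<sigma> w = (\<Prod>i\<in>{1..n}. 1 + z i * w)"
    using complex_poly_factorization[of P n] P by auto
  have "cmod (z i) < 1" if i: "i \<in> {1..n}" for i
  proof (rule ccontr)
    assume "\<not> cmod (z i) < 1"
    then have "z i \<noteq> 0" "cmod (- 1 / z i) \<le> 1" by (auto simp: norm_divide divide_simps)
    moreover have "gen_poly n \<sigma> (- 1 / z i) = 0"
      unfolding z using i \<open>z i \<noteq> 0\<close> by (intro prod_zero) (auto intro!: bexI[of _ i])
    ultimately show False using nz by blast
  qed
  moreover have "\<sigma> = symmetrization n z"
  proof
    have "(\<Sum>k\<le>n. (\<sigma>(0 := 1)) k * w ^ k) = (\<Sum>k\<le>n. elem_sym n k z * w ^ k)" for w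
      using z[of w] unfolding gen_poly_def prod_linear_eq_elem_sym by simp
    then have "\<forall>k\<le>n. (\<sigma>(0 := 1)) k = elem_sym n k z"
      by (subst polyfun_eq_coeffs[symmetric]) blast
    then show "\<sigma> k = symmetrization n z k" for k
      using assms by (cases "k \<in> {1..n}") (auto simp: symmetrization_def extensional_def)
  qed
  \<comment> \<open>The factorization leaves z arbitrary off \<open>{1..n}\<close>, whereas the
    polydisc consists of extensional functions.\<close>
  moreover have "symmetrization n z = symmetrization n (restrict z {1..n})"
    unfolding symmetrization_def elem_sym_def
    by (intro restrict_ext sum.cong prod.cong refl) auto
  ultimately show "\<sigma> \<in> open_sym_polydisc n"
    unfolding open_sym_polydisc_def by (auto intro!: image_eqI[of _ _ "restrict z {1..n}"])
qed

text \<open>The Blaschke factor (w + cnj z) / (1 + z * w) maps the closed disc into itself.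
  Multiplied over all z i, this bounds the reversal by the polynomial.\<close>

lemma norm_add_cnj_le:
  assumes "cmod z < 1" "cmod w \<le> 1"
  shows "cmod (w + cnj z) \<le> cmod (1 + z * w)"
proof -
  have "(cmod (1 + z * w))\<^sup>2 - (cmod (w + cnj z))\<^sup>2 = (1 - (cmod z)\<^sup>2) * (1 - (cmod w)\<^sup>2)"
    unfolding cmod_power2 by (simp add: power2_eq_square algebra_simps)
  moreover have "(cmod z)\<^sup>2 \<le> 1" "(cmod w)\<^sup>2 \<le> 1"
    using assms by (simp_all add: power_le_one)
  ultimately have "(cmod (w + cnj z))\<^sup>2 \<le> (cmod (1 + z * w))\<^sup>2"
    by (smt (verit) mult_nonneg_nonneg)
  then show ?thesis by (simp add: power2_le_iff_abs_le)
qed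

lemma gen_poly_rev_le:
  assumes "\<sigma> \<in> open_sym_polydisc n" "cmod w \<le> 1"
  shows "cmod (gen_poly_rev n \<sigma> w) \<le> cmod (gen_poly n \<sigma> w)"
proof -
  obtain z where z: "\<And>i. i \<in> {1..n} \<Longrightarrow> cmod (z i) < 1" and \<sigma>: "\<sigma> = symmetrization n z"
    using assms(1) by (rule open_sym_polydiscE) blast
  show ?thesis
    unfolding \<sigma> gen_poly_symmetrization gen_poly_rev_symmetrization prod_norm[symmetric]
    using norm_add_cnj_le[OF z assms(2)] by (intro prod_mono) auto
qed

lemma open_sym_polydisc_last_less:
  assumes "\<sigma> \<in> open_sym_polydisc n" "n \<ge> 1"
  shows "cmod (\<sigma> n) < 1"
proof -
  obtain z where z: "\<And>i. i \<in> {1..n} \<Longrightarrow> cmod (z i) < 1" and \<sigma>: "\<sigma> = symmetrization n z"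
    using assms(1) by (rule open_sym_polydiscE) blast
  have "cmod (\<sigma> n) = (\<Prod>i\<in>{1..n}. cmod (z i))"
    using assms(2) by (simp add: \<sigma> symmetrization_def elem_sym_top prod_norm)
  \<comment> \<open>One factor is split off to keep the inequality strict; the others are only
    bounded by 1.\<close>
  also have "\<dots> = cmod (z 1) * (\<Prod>i\<in>{Suc 1..n}. cmod (z i))"
    using assms(2) by (rule prod.atLeast_Suc_atMost)
  also have "(\<Prod>i\<in>{Suc 1..n}. cmod (z i)) \<le> 1"
    using z by (intro prod_le_1) (simp add: less_imp_le)
  then have "cmod (z 1) * (\<Prod>i\<in>{Suc 1..n}. cmod (z i)) \<le> cmod (z 1)"
    by (simp add: mult_left_le)
  finally show ?thesis using z[of 1] assms(2) by simp
qed

section \<open>The Schur-Cohn step on the open symmetrized polydisc\<close>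

definition sym_lift :: "nat \<Rightarrow> (nat \<Rightarrow> complex) \<times> complex \<Rightarrow> (nat \<Rightarrow> complex)" where
  "sym_lift n = (\<lambda>(\<beta>, p). \<lambda>j\<in>{1..n}. if j < n then \<beta> j + cnj (\<beta> (n - j)) * p else p)"

lemma gen_poly_sym_lift:
    "gen_poly (Suc m) (sym_lift (Suc m) (\<beta>, p)) w = gen_poly m \<beta> w + p * (w * gen_poly_rev m \<beta> w)"
      (is ?gen)
  and gen_poly_rev_sym_lift:
    "gen_poly_rev (Suc m) (sym_lift (Suc m) (\<beta>, p)) w
      = w * gen_poly_rev m \<beta> w + cnj p * gen_poly m \<beta> w" (is ?rev)
proof -
  \<comment> \<open>Padding \<beta> with 1 at index 0 and 0 at index \<open>Suc m\<close> makes one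
    formula cover every coefficient of the lift, including 1 at k = 0 and p at k =
    \<open>Suc m\<close>. The sums below are written in both orders so that equal powers of w line
    up.\<close>
  define b where "b = (\<lambda>k. if k = 0 then 1 else if k \<le> m then \<beta> k else 0)"
  have lift: "((sym_lift (Suc m) (\<beta>, p))(0 := 1)) k = b k + cnj (b (Suc m - k)) * p"
    if "k \<le> Suc m" for k
    using that by (auto simp: sym_lift_def b_def)
  have gen: "gen_poly m \<beta> w = (\<Sum>k\<le>Suc m. b k * w ^ k)"
    unfolding gen_poly_def sum.atMost_Suc by (auto simp: b_def intro!: sum.cong)
  have gen': "gen_poly m \<beta> w = (\<Sum>k\<le>Suc m. b (Suc m - k) * w ^ (Suc m - k))"
    unfolding gen
    by (rule sum.reindex_bij_witness[of _ "\<lambda>k. Suc m - k" "\<lambda>k. Suc m - k"]) auto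
  have rev: "w * gen_poly_rev m \<beta> w = (\<Sum>k\<le>Suc m. cnj (b k) * w ^ (Suc m - k))"
    unfolding gen_poly_rev_def sum.atMost_Suc sum_distrib_left
    by (auto simp: b_def Suc_diff_le intro!: sum.cong)
  have rev': "w * gen_poly_rev m \<beta> w = (\<Sum>k\<le>Suc m. cnj (b (Suc m - k)) * w ^ k)"
    unfolding rev
    by (rule sum.reindex_bij_witness[of _ "\<lambda>k. Suc m - k" "\<lambda>k. Suc m - k"]) auto
  have "gen_poly (Suc m) (sym_lift (Suc m) (\<beta>, p)) w
      = (\<Sum>k\<le>Suc m. b k * w ^ k + p * (cnj (b (Suc m - k)) * w ^ k))"
    unfolding gen_poly_def by (intro sum.cong refl) (simp add: lift algebra_simps del: fun_upd_apply)
  then show ?gen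
    unfolding gen rev' by (simp only: sum.distrib sum_distrib_left)
  have "gen_poly_rev (Suc m) (sym_lift (Suc m) (\<beta>, p)) w
      = (\<Sum>k\<le>Suc m. cnj (b k) * w ^ (Suc m - k) + cnj p * (b (Suc m - k) * w ^ (Suc m - k)))"
    unfolding gen_poly_rev_def by (intro sum.cong refl) (simp add: lift algebra_simps del: fun_upd_apply)
  then show ?rev
    unfolding rev gen' by (simp only: sum.distrib sum_distrib_left)
qed

text \<open>At a zero of the lifted polynomial in the closed disc, |f| = |p w g| \<le> |p| |f|,
  where g is the reversal of f. As |p| < 1, this contradicts that f has no zero there.\<close>

lemma sym_lift_in_open_sym_polydisc:
  assumes "\<beta> \<in> open_sym_polydisc m" "cmod p < 1"
  shows "sym_lift (Suc m) (\<beta>, p) \<in> open_sym_polydisc (Suc m)"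
proof -
  have ext: "sym_lift (Suc m) (\<beta>, p) \<in> extensional {1..Suc m}"
    by (auto simp: sym_lift_def)
  have \<beta>: "\<beta> \<in> extensional {1..m}"
    using assms(1) by (auto simp: open_sym_polydisc_def symmetrization_def)
  show ?thesis
    unfolding in_open_sym_polydisc_iff[OF ext]
  proof (intro allI impI notI)
    fix w assume w: "cmod w \<le> 1"
    let ?f = "gen_poly m \<beta> w" and ?g = "gen_poly_rev m \<beta> w"
    assume "gen_poly (Suc m) (sym_lift (Suc m) (\<beta>, p)) w = 0"
    then have "?f = - (p * (w * ?g))" by (simp add: gen_poly_sym_lift add_eq_0_iff2)
    then have "cmod ?f = cmod p * (cmod w * cmod ?g)" by (simp add: norm_mult mult_ac)
    also have "\<dots> \<le> cmod p * cmod ?f"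
      using gen_poly_rev_le[OF assms(1) w] w
      by (intro mult_left_mono) (auto intro: order.trans[OF mult_left_le_one_le])
    finally have "(1 - cmod p) * cmod ?f \<le> 0" by (simp add: algebra_simps)
    moreover have "?f \<noteq> 0" using assms(1) w in_open_sym_polydisc_iff[OF \<beta>] by blast
    ultimately show False using assms(2) by (simp add: mult_le_0_iff)
  qed
qed

lemma open_sym_polydisc_sym_lift:
  assumes \<sigma>: "\<sigma> \<in> open_sym_polydisc (Suc m)"
  obtains \<beta> p where "\<beta> \<in> open_sym_polydisc m" "cmod p < 1" "\<sigma> = sym_lift (Suc m) (\<beta>, p)"
proof -
  define p where "p = \<sigma> (Suc m)"
  have p: "cmod p < 1" unfolding p_def using open_sym_polydisc_last_less[OF \<sigma>] by simp
  define d where "d = 1 - p * cnj p"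
  have "(cmod p)\<^sup>2 < 1" using p by (simp add: power_less_one_iff abs_square_less_1)
  then have d: "d \<noteq> 0" unfolding d_def complex_norm_square[symmetric]
    by (metis eq_iff_diff_eq_0 less_irrefl of_real_1 of_real_eq_iff of_real_power)
  have d_cnj: "cnj d = d" by (simp add: d_def mult.commute)
  \<comment> \<open>This solves the equation for \<sigma> j together with the conjugated equation
    for \<sigma> (\<open>Suc m\<close> - j), a linear system in \<beta> j and cnj (\<beta>
    (\<open>Suc m\<close> - j)) with determinant d. Since d is real, conjugation passes through the
    division.\<close>
  define \<beta> where "\<beta> = (\<lambda>j\<in>{1..m}. (\<sigma> j - p * cnj (\<sigma> (Suc m - j))) / d)"
  have ext: "\<sigma> \<in> extensional {1..Suc m}"
    using \<sigma> by (auto simp: open_sym_polydisc_def symmetrization_def)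
  have eq: "\<sigma> = sym_lift (Suc m) (\<beta>, p)"
  proof
    fix j
    consider "j \<in> {1..m}" | "j = Suc m" | "j \<notin> {1..Suc m}" by fastforce
    then show "\<sigma> j = sym_lift (Suc m) (\<beta>, p) j"
    proof cases
      case 1
      then have "Suc m - (Suc m - j) = j" "Suc m - j \<in> {1..m}" "j < Suc m" by auto
      then have "sym_lift (Suc m) (\<beta>, p) j
          = (\<sigma> j - p * cnj (\<sigma> (Suc m - j)) + (cnj (\<sigma> (Suc m - j)) - cnj p * \<sigma> j) * p) / d"
        using 1 by (simp add: sym_lift_def \<beta>_def d_cnj add_divide_distrib)
      also have "\<dots> = \<sigma> j * d / d" by (simp add: d_def algebra_simps)
      finally show ?thesis using d by simp
    next
      case 2
      then show ?thesis by (simp add: sym_lift_def p_def)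
    next
      case 3
      then show ?thesis using ext by (auto simp: sym_lift_def extensional_def)
    qed
  qed
  have ext\<beta>: "\<beta> \<in> extensional {1..m}" by (simp add: \<beta>_def)
  have "\<beta> \<in> open_sym_polydisc m"
    unfolding in_open_sym_polydisc_iff[OF ext\<beta>]
  proof (intro allI impI notI)
    fix w assume w: "cmod w \<le> 1" and 0: "gen_poly m \<beta> w = 0"
    let ?f = "gen_poly (Suc m) \<sigma> w" and ?g = "gen_poly_rev (Suc m) \<sigma> w"
    \<comment> \<open>At a zero of the polynomial of \<beta>, only the terms with its reversal
      survive in the two lift identities, and they differ by the factor p.\<close>
    have "?f = p * ?g"
      unfolding eq gen_poly_sym_lift gen_poly_rev_sym_lift 0 by simp
    then have "cmod ?f = cmod p * cmod ?g" by (simp add: norm_mult)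
    also have "\<dots> \<le> cmod p * cmod ?f"
      using gen_poly_rev_le[OF \<sigma> w] by (intro mult_left_mono) auto
    finally have "(1 - cmod p) * cmod ?f \<le> 0" by (simp add: algebra_simps)
    moreover have "?f \<noteq> 0" using \<sigma> w in_open_sym_polydisc_iff[OF ext] by blast
    ultimately show False using p by (simp add: mult_le_0_iff)
  qed
  then show thesis using that p eq by blast
qed

lemma image_sym_lift_open:
  "sym_lift (Suc m) ` (open_sym_polydisc m \<times> ball 0 1) = open_sym_polydisc (Suc m)"
proof
  show "open_sym_polydisc (Suc m) \<subseteq> sym_lift (Suc m) ` (open_sym_polydisc m \<times> ball 0 1)"
  proof
    fix \<sigma> assume "\<sigma> \<in> open_sym_polydisc (Suc m)"
    then obtain \<beta> p where "\<beta> \<in> open_sym_polydisc m" "cmod p < 1" "\<sigma> = sym_lift (Suc m) (\<beta>, p)"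
      by (rule open_sym_polydisc_sym_lift)
    then show "\<sigma> \<in> sym_lift (Suc m) ` (open_sym_polydisc m \<times> ball 0 1)" by auto
  qed
qed (auto simp: sym_lift_in_open_sym_polydisc)

section \<open>Compactness and passage to the closures\<close>

lemma compactin_sym_polydisc: "compactin (complex_space n) (sym_polydisc n)"
proof -
  \<comment> \<open>The radius is the number of terms of the k-th elementary symmetric polynomial,
    each of modulus at most 1 on the polydisc.\<close>
  define B where "B = (\<Pi>\<^sub>E k\<in>{1..n}. cball (0::complex) (real (card {I. I \<subseteq> {1..n} \<and> card I = k})))"
  have B: "compactin (complex_space n) B"
    unfolding B_def complex_space_def by (simp add: compactin_PiE)
  have "Hausdorff_space (complex_space n)"
    by (simp add: complex_space_def Hausdorff_space_product_topology)
  then have "closedin (complex_space n) B" using B by (rule compactin_imp_closedin)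
  moreover have "open_sym_polydisc n \<subseteq> B"
  proof
    fix \<sigma> assume "\<sigma> \<in> open_sym_polydisc n"
    then obtain z where z: "\<And>i. i \<in> {1..n} \<Longrightarrow> cmod (z i) < 1" and \<sigma>: "\<sigma> = symmetrization n z"
    by (rule open_sym_polydiscE) blast
    have "cmod (elem_sym n k z) \<le> real (card {I. I \<subseteq> {1..n} \<and> card I = k})" for k
    proof -
      have "cmod (elem_sym n k z) \<le> (\<Sum>I | I \<subseteq> {1..n} \<and> card I = k. 1)"
        unfolding elem_sym_def
      proof (rule sum_norm_le)
        fix I assume "I \<in> {I. I \<subseteq> {1..n} \<and> card I = k}"
        then show "cmod (\<Prod>i\<in>I. z i) \<le> 1"
          unfolding prod_norm[symmetric] by (intro prod_le_1) (use z in \<open>force intro: less_imp_le\<close>)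
      qed
      then show ?thesis by simp
    qed
    then show "\<sigma> \<in> B" by (auto simp: B_def \<sigma> symmetrization_def)
  qed
  ultimately have "sym_polydisc n \<subseteq> B"
    unfolding sym_polydisc_def by (intro closure_of_minimal)
  then show ?thesis
    by (intro closed_compactin[OF B]) (simp_all add: sym_polydisc_def)
qed

lemma continuous_map_sym_lift:
  "continuous_map (prod_topology (complex_space m) euclidean) (complex_space (Suc m)) (sym_lift (Suc m))"
proof -
  let ?X = "prod_topology (complex_space m) (euclidean :: complex topology)"
  have snd: "continuous_map ?X euclidean (\<lambda>x. snd x)" by (rule continuous_map_snd)
  have coord: "continuous_map ?X euclidean (\<lambda>x. fst x j)" if "j \<in> {1..m}" for j
    using continuous_map_compose[where g = "\<lambda>x. x j", OF continuous_map_fst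
        continuous_map_product_projection[OF that]]
    by (simp add: complex_space_def comp_def)
  show ?thesis
    unfolding complex_space_def[of "Suc m"] continuous_map_componentwise
  proof (intro conjI ballI)
    fix j assume j: "j \<in> {1..Suc m}"
    show "continuous_map ?X euclidean (\<lambda>x. sym_lift (Suc m) x j)"
    proof (cases "j = Suc m")
      case True
      then have "(\<lambda>x. sym_lift (Suc m) x j) = (\<lambda>x. snd x)"
        by (auto simp: sym_lift_def)
      then show ?thesis using snd by simp
    next
      case False
      then have "(\<lambda>x. sym_lift (Suc m) x j) = (\<lambda>x. fst x j + cnj (fst x (Suc m - j)) * snd x)"
        using j by (auto simp: sym_lift_def)
      moreover have "j \<in> {1..m}" "Suc m - j \<in> {1..m}" using j False by auto
      ultimately show ?thesis
        using coord[of j] coord[of "Suc m - j"] snd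
        by (simp add: continuous_map_atin tendsto_intros)
    qed
  qed (auto simp: sym_lift_def)
qed

text \<open>For |p| = 1 the linear system for \<beta> degenerates, so \<beta> is obtained by
  compactness: the image of the compact product is closed and contains the open symmetrized
  polydisc, hence its closure. The other inclusion is continuity.\<close>

lemma sym_polydisc_Suc:
  "sym_polydisc (Suc m) = sym_lift (Suc m) ` (sym_polydisc m \<times> cball 0 1)"
proof
  let ?X = "prod_topology (complex_space m) (euclidean :: complex topology)"
  let ?A = "open_sym_polydisc m \<times> ball (0::complex) 1"
  have cl: "?X closure_of ?A = sym_polydisc m \<times> cball 0 1"
    by (simp add: closure_of_Times sym_polydisc_def)
  have "compactin ?X (sym_polydisc m \<times> cball 0 1)"
    by (simp add: compactin_Times compactin_sym_polydisc)
  then have "compactin (complex_space (Suc m)) (sym_lift (Suc m) ` (sym_polydisc m \<times> cball 0 1))"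
    by (rule image_compactin[OF _ continuous_map_sym_lift])
  moreover have "Hausdorff_space (complex_space (Suc m))"
    by (simp add: complex_space_def Hausdorff_space_product_topology)
  ultimately have "closedin (complex_space (Suc m)) (sym_lift (Suc m) ` (sym_polydisc m \<times> cball 0 1))"
    by (rule compactin_imp_closedin[rotated])
  moreover have "?A \<subseteq> topspace ?X"
    by (auto simp: complex_space_def open_sym_polydisc_def symmetrization_def)
  then have "?A \<subseteq> sym_polydisc m \<times> cball 0 1"
    unfolding cl[symmetric] by (rule closure_of_subset)
  ultimately show "sym_polydisc (Suc m) \<subseteq> sym_lift (Suc m) ` (sym_polydisc m \<times> cball 0 1)"
    unfolding sym_polydisc_def[of "Suc m"] image_sym_lift_open[symmetric]
    by (intro closure_of_minimal image_mono)
  show "sym_lift (Suc m) ` (sym_polydisc m \<times> cball 0 1) \<subseteq> sym_polydisc (Suc m)"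
    using continuous_map_image_closure_subset[OF continuous_map_sym_lift, of m ?A]
    unfolding cl image_sym_lift_open sym_polydisc_def[of "Suc m"] .
qed

theorem theorem1p1:
  fixes n :: nat and s :: "nat \<Rightarrow> complex" and p :: complex
  assumes "n \<ge> 2"
  shows "(\<lambda>j\<in>{1..n}. if j < n then s j else p) \<in> sym_polydisc n \<longleftrightarrow>
         cmod p \<le> 1 \<and>
         (\<exists>\<beta>\<in>sym_polydisc (n - 1). \<forall>j\<in>{1..n-1}. s j = \<beta> j + cnj (\<beta> (n - j)) * p)"
proof -
  have n: "sym_polydisc n = sym_lift n ` (sym_polydisc (n - 1) \<times> cball 0 1)"
    using sym_polydisc_Suc[of "n - 1"] assms by simp
  \<comment> \<open>Coordinate n identifies q with p, which turns membership of q in the closed disc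
    into |p| \<le> 1; the remaining coordinates are the equations for s.\<close>
  have "(\<lambda>j\<in>{1..n}. if j < n then s j else p) = sym_lift n (\<beta>, q) \<longleftrightarrow>
      p = q \<and> (\<forall>j\<in>{1..n-1}. s j = \<beta> j + cnj (\<beta> (n - j)) * p)" (is "?l = ?r \<longleftrightarrow> ?R") for \<beta> q
  proof
    assume eq: "?l = ?r"
    have "p = q" using fun_cong[OF eq, of n] assms by (simp add: sym_lift_def)
    moreover have "s j = \<beta> j + cnj (\<beta> (n - j)) * q" if "j \<in> {1..n-1}" for j
    proof -
      have "j < n" using that by auto
      then show ?thesis using fun_cong[OF eq, of j] that by (simp add: sym_lift_def)
    qed
    ultimately show ?R by simp
  next
    assume ?R
    then show "?l = ?r" by (auto simp: sym_lift_def)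
  qed
  then show ?thesis unfolding n by (auto simp: image_iff)
qed

end
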